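(* For any $\lambda>0$ and $\mu>0$, the critical point sets of $\Psi_{\lambda,\mu}$ and $\widetilde F_\mu$ are identical: $\mathrm{crit}\,\Psi_{\lambda,\mu}=\mathrm{crit}\,\widetilde F_\mu$. Furthermore, if $(\overline U^*,\overline V^* )$ is a global minimizer of $\Psi_{\lambda,\mu}$ satisfying $$\frac{2\lambda}{\mu}\ge\sqrt{\mathrm{rank}_+\big(\overline U^*(\overline V^* )^\top\big)}\,\big\|\overline U^*(\overline V^* )^\top\big\|_F,$$ then $$\mathrm{rank}_+\big(\overline U^*(\overline V^* )^\top\big)=\|\overline U^*\|_{2,0}=\|\overline V^*\|_{2,0}.$$
   Context: $n,m,r$ are positive integers and $X\in\mathbb{R}_+^{n\times m}$. For a matrix $W$, $\|W\|_{2,0}$ is the number of its nonzero columns, $\|W\|_F$ its Frobenius norm; $\delta_{\mathbb{R}_+}(W)=0$ if $W\ge0$ entrywise and $+\infty$ otherwise. For $(U,V)\in\mathbb{R}^{n\times r}\times\mathbb{R}^{m\times r}$, $$F_\mu(U,V)=\tfrac12\|X-UV^\top\|_F^2+\tfrac\mu2(\|U\|_F^2+\|V\|_F^2),$$ $$\widetilde F_\mu(U,V)=F_\mu(U,V)+\delta_{\mathbb{R}_+}(U)+\delta_{\mathbb{R}_+}(V),\qquad \Psi_{\lambda,\mu}(U,V)=\widetilde F_\mu(U,V)+\lambda(\|U\|_{2,0}+\|V\|_{2,0}).$$ For an extended-real-valued $h$, $\mathrm{crit}\,h$ is the set of points $x$ with $0\in\partial h(x)$, where $\partial$ denotes the limiting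 (Mordukhovich) subdifferential. The nonnegative rank $\mathrm{rank}_+(A)$ of an entrywise nonnegative matrix $A$ is the smallest integer $s$ such that $A=BC^\top$ with $B,C$ entrywise nonnegative having $s$ columns. *)

theory Defs
  imports "HOL-Analysis.Analysis"
begin

(* A p x q real matrix has type real^'q^'p.  The inner product of this type is
   trace (transpose A ** B), so its norm is the Frobenius norm: *)
lemma norm_matrix_eq_frobenius:
  fixes A :: "real^'q^'p"
  shows "norm A = sqrt (\<Sum>i\<in>UNIV. \<Sum>j\<in>UNIV. (A $ i $ j)\<^sup>2)"
  by (simp add: norm_vec_def L2_set_def sum_nonneg)

definition regular_subdiff :: "('a::euclidean_space \<Rightarrow> ereal) \<Rightarrow> 'a \<Rightarrow> 'a set" where
  "regular_subdiff h x =
     {v. \<bar>h x\<bar> \<noteq> \<infinity> \<and>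
         0 \<le> Liminf (at x) (\<lambda>y. (h y - h x - ereal (v \<bullet> (y - x))) / ereal (norm (y - x)))}"

definition limiting_subdiff :: "('a::euclidean_space \<Rightarrow> ereal) \<Rightarrow> 'a \<Rightarrow> 'a set" where
  "limiting_subdiff h x =
     {v. \<bar>h x\<bar> \<noteq> \<infinity> \<and>
         (\<exists>(xs :: nat \<Rightarrow> 'a) (vs :: nat \<Rightarrow> 'a).
            xs \<longlonglongrightarrow> x \<and> (\<lambda>k. h (xs k)) \<longlonglongrightarrow> h x \<and>
            (\<forall>k. vs k \<in> regular_subdiff h (xs k)) \<and> vs \<longlonglongrightarrow> v)}"

definition crit :: "('a::euclidean_space \<Rightarrow> ereal) \<Rightarrow> 'a set" where
  "crit h = {x. 0 \<in> limiting_subdiff h x}"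

definition nonneg_mat :: "real^'q^'p \<Rightarrow> bool" where
  "nonneg_mat A \<longleftrightarrow> (\<forall>i j. 0 \<le> A $ i $ j)"

definition ind_nonneg :: "real^'q^'p \<Rightarrow> ereal" where
  "ind_nonneg W = (if nonneg_mat W then 0 else \<infinity>)"

definition nnz_cols :: "real^'q^'p \<Rightarrow> nat" where
  "nnz_cols W = card {j. column j W \<noteq> 0}"

(* The number s of columns of the factors varies, so they are functions on row and
   column indices, of which only the columns k < s matter.  The value s = 0 is
   admitted: the zero matrix has nonnegative rank 0. *)
definition nonneg_rank :: "real^'q^'p \<Rightarrow> nat" where
  "nonneg_rank A =
     (LEAST s. \<exists>(B :: 'p \<Rightarrow> nat \<Rightarrow> real) (C :: 'q \<Rightarrow> nat \<Rightarrow> real).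
        (\<forall>i. \<forall>k<s. 0 \<le> B i k) \<and> (\<forall>j. \<forall>k<s. 0 \<le> C j k) \<and>
        (\<forall>i j. A $ i $ j = (\<Sum>k<s. B i k * C j k)))"

definition F_reg :: "real^'m^'n \<Rightarrow> real \<Rightarrow> (real^'r^'n) \<times> (real^'r^'m) \<Rightarrow> real" where
  "F_reg X \<mu> = (\<lambda>(U, V).
     1/2 * (norm (X - U ** transpose V))\<^sup>2 + \<mu>/2 * ((norm U)\<^sup>2 + (norm V)\<^sup>2))"

definition F_nonneg :: "real^'m^'n \<Rightarrow> real \<Rightarrow> (real^'r^'n) \<times> (real^'r^'m) \<Rightarrow> ereal" where
  "F_nonneg X \<mu> = (\<lambda>(U, V). ereal (F_reg X \<mu> (U, V)) + ind_nonneg U + ind_nonneg V)"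

definition Psi :: "real^'m^'n \<Rightarrow> real \<Rightarrow> real \<Rightarrow> (real^'r^'n) \<times> (real^'r^'m) \<Rightarrow> ereal" where
  "Psi X l \<mu> = (\<lambda>(U, V).
     F_nonneg X \<mu> (U, V) + ereal (l * (real (nnz_cols U) + real (nnz_cols V))))"

definition global_minimizer :: "('a \<Rightarrow> ereal) \<Rightarrow> 'a \<Rightarrow> bool" where
  "global_minimizer h x \<longleftrightarrow> (\<forall>y. h x \<le> h y)"

end

theory Submission
  imports Defs
begin

text \<open>
  Near a point the number of nonzero columns cannot drop, and it does not grow along feasible
  segments that create no new nonzero column.  Hence a critical point of \<open>\<Psi>\<close> satisfies the
  first-order variational inequality for the smooth part \<open>F\<close> in all directions supported on its
  nonzero columns.  If \<open>U\<^sub>k = 0\<close>, testing with the direction that shrinks \<open>V\<^sub>k\<close> to \<open>0\<close> leaves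
  \<open>U V\<^sup>T\<close> unchanged and gives \<open>- \<mu> \<parallel>V\<^sub>k\<parallel>\<^sup>2 \<ge> 0\<close>, so \<open>U\<close> and \<open>V\<close> have the same zero columns; there
  the gradient of \<open>F\<close> vanishes, and the inequality extends to all feasible directions.  The
  resulting characterization does not depend on \<open>\<lambda> \<ge> 0\<close>, and \<open>\<lambda> = 0\<close> is the case without the
  column penalty.

  If a minimizer had more nonzero columns than \<open>s = rank\<^sub>+(A)\<close>, where \<open>A = U V\<^sup>T\<close>, one could replace it
  by a nonnegative factorization of \<open>A\<close> with \<open>s\<close> columns rescaled to \<open>\<parallel>U\<^sub>k\<parallel> = \<parallel>V\<^sub>k\<parallel>\<close>.  By
  Cauchy-Schwarz and nonnegativity its regularization term is at most
  \<open>\<mu> sqrt(s) \<parallel>A\<parallel> \<le> 2 \<lambda>\<close>, which is compensated by the saving of at least \<open>2 \<lambda>\<close> in the penalty.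
\<close>

section \<open>Regular and limiting subgradients\<close>

lemma regular_subdiff_iff:
  fixes h :: "'a::euclidean_space \<Rightarrow> ereal"
  assumes hx: "h x = ereal a"
  shows "v \<in> regular_subdiff h x \<longleftrightarrow>
    (\<forall>e>0. \<forall>\<^sub>F y in at x. ereal (a + v \<bullet> (y - x) - e * norm (y - x)) \<le> h y)"
proof -
  let ?q = "\<lambda>y. (h y - h x - ereal (v \<bullet> (y - x))) / ereal (norm (y - x))"
  \<comment> \<open>For infinite \<open>h y\<close> the quotient is infinite of the same sign, so
    both sides are true or both false; otherwise the positive number \<open>norm (y - x)\<close> is
    multiplied out.\<close>
  have le: "ereal (a + v \<bullet> (y - x) - e * norm (y - x)) \<le> h y \<longleftrightarrow> ereal (- e) \<le> ?q y"
    if "y \<noteq> x" for y e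
    using that hx by (cases "h y") (auto simp: field_simps)
  have near: "\<forall>\<^sub>F y in at x. y \<noteq> x"
    by (simp add: eventually_at_filter)
  have "0 \<le> Liminf (at x) ?q \<longleftrightarrow> (\<forall>e>0. \<forall>\<^sub>F y in at x. ereal (- e) \<le> ?q y)"
  proof
    assume L: "0 \<le> Liminf (at x) ?q"
    show "\<forall>e>0. \<forall>\<^sub>F y in at x. ereal (- e) \<le> ?q y"
    proof (intro allI impI)
      fix e :: real assume "e > 0"
      then have "\<forall>\<^sub>F y in at x. ereal (- e) < ?q y"
        using L unfolding le_Liminf_iff by auto
      then show "\<forall>\<^sub>F y in at x. ereal (- e) \<le> ?q y"
        by (rule eventually_mono) auto
    qed
  next
    assume R: "\<forall>e>0. \<forall>\<^sub>F y in at x. ereal (- e) \<le> ?q y"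
    show "0 \<le> Liminf (at x) ?q"
      unfolding le_Liminf_iff
    proof (intro allI impI)
      fix c :: ereal assume "c < 0"
      \<comment> \<open>Since \<open>c\<close> may be minus infinity, a real \<open>e\<close> is put
        between \<open>c\<close> and 0, and \<open>- e\<close> serves as the tolerance.\<close>
      then obtain e where e: "c < ereal e" "ereal e < 0"
        using ereal_dense2 by blast
      then have "\<forall>\<^sub>F y in at x. ereal (- (- e)) \<le> ?q y"
        by (intro R[rule_format]) auto
      then show "\<forall>\<^sub>F y in at x. c < ?q y"
        using e(1) by (auto elim!: eventually_mono)
    qed
  qed
  also have "\<dots> \<longleftrightarrow> (\<forall>e>0. \<forall>\<^sub>F y in at x. ereal (a + v \<bullet> (y - x) - e * norm (y - x)) \<le> h y)"
    using near by (intro all_cong1 imp_cong refl eventually_cong) (auto simp: le elim!: eventually_mono)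
  finally show ?thesis
    using hx by (simp add: regular_subdiff_def)
qed

lemma has_derivative_at_bound:
  assumes "(f has_derivative f') (at x)" "e > 0"
  shows "\<forall>\<^sub>F y in nhds x. norm (f y - f x - f' (y - x)) \<le> e * norm (y - x)"
  using assms unfolding has_derivative_at_alt eventually_nhds_metric dist_norm by blast

text \<open>Along the ray \<open>x + t *\<^sub>R d\<close> the minorant given by \<open>v\<close>
  lies below \<open>h\<close>, which lies below \<open>f + c\<close>; dividing by \<open>t\<close>
  compares the slopes. An upper bound on this single ray suffices, so \<open>h\<close> may jump
  upwards in other directions. In the application \<open>c\<close> is the column penalty at
  \<open>x\<close>.\<close>

lemma regular_subdiff_le_derivative:
  fixes h :: "'a::euclidean_space \<Rightarrow> ereal"
  assumes v: "v \<in> regular_subdiff h x"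
    and f: "(f has_derivative f') (at x)"
    and hx: "h x = ereal (f x + c)"
    and hd: "\<forall>\<^sub>F t in at_right 0. h (x + t *\<^sub>R d) \<le> ereal (f (x + t *\<^sub>R d) + c)"
  shows "v \<bullet> d \<le> f' d"
proof (cases "d = 0")
  case True
  then show ?thesis
    using has_derivative_bounded_linear[OF f] by (simp add: linear_simps)
next
  case False
  have lin: "f' (t *\<^sub>R d) = t * f' d" for t
    using has_derivative_bounded_linear[OF f] by (simp add: linear_simps)
  have lim0: "((\<lambda>t. x + t *\<^sub>R d) \<longlongrightarrow> x) (at_right 0)"
    by (rule tendsto_eq_intros refl | simp)+
  \<comment> \<open>The filter \<open>at x\<close> excludes \<open>x\<close> itself, and the ray
    avoids \<open>x\<close> because \<open>d\<close> is nonzero.\<close>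
  have lim: "filterlim (\<lambda>t. x + t *\<^sub>R d) (at x) (at_right 0)"
    using lim0 False by (auto simp: filterlim_at eventually_at_filter)
  have "v \<bullet> d \<le> f' d + e" if "e > 0" for e
  proof -
    \<comment> \<open>Two errors of size \<open>e' * norm d\<close> occur, one from the subgradient
      and one from the derivative; together they make \<open>e\<close>.\<close>
    define e' where "e' = e / (2 * norm d)"
    have e': "e' > 0" "2 * e' * norm d = e"
      using False that by (auto simp: e'_def)
    have 1: "\<forall>\<^sub>F t in at_right 0.
        ereal (f x + c + v \<bullet> (t *\<^sub>R d) - e' * norm (t *\<^sub>R d)) \<le> h (x + t *\<^sub>R d)"
      using eventually_compose_filterlim[OF v[unfolded regular_subdiff_iff[of h, OF hx], rule_format, OF e'(1)] lim]
      by simp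
    have 2: "\<forall>\<^sub>F t in at_right 0.
        norm (f (x + t *\<^sub>R d) - f x - f' (t *\<^sub>R d)) \<le> e' * norm (t *\<^sub>R d)"
      using eventually_compose_filterlim[OF has_derivative_at_bound[OF f e'(1)] lim0] by simp
    have "\<forall>\<^sub>F t in at_right (0::real). v \<bullet> d \<le> f' d + e"
      using 1 2 hd eventually_at_right_less[of 0]
    proof eventually_elim
      case (elim t)
      have "f x + c + t * (v \<bullet> d) - e' * (t * norm d) \<le> f (x + t *\<^sub>R d) + c"
        using order.trans[OF elim(1,3)] elim(4) by simp
      moreover have "f (x + t *\<^sub>R d) - f x - t * f' d \<le> e' * (t * norm d)"
        using elim(2,4) by (simp add: lin)
      ultimately have "t * (v \<bullet> d) \<le> t * (f' d + 2 * e' * norm d)"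
        by (simp add: algebra_simps)
      then show ?case
        using elim(4) e'(2) by simp
    qed
    then show ?thesis
      by (auto simp: eventually_const_iff)
  qed
  then show ?thesis
    by (rule field_le_epsilon)
qed

text \<open>A partial converse: if \<open>f + c\<close> supports \<open>h\<close> from below near
  \<open>x\<close> at points of finite value, and \<open>f'\<close> is nonnegative towards these
  points, then the Taylor error of \<open>f\<close> is the only possible loss.\<close>

lemma zero_in_regular_subdiffI:
  fixes h :: "'a::euclidean_space \<Rightarrow> ereal"
  assumes f: "(f has_derivative f') (at x)"
    and hx: "h x = ereal (f x + c)"
    and hy: "\<forall>\<^sub>F y in at x. h y = \<infinity> \<or> ereal (f y + c) \<le> h y \<and> 0 \<le> f' (y - x)"
  shows "0 \<in> regular_subdiff h x"
  unfolding regular_subdiff_iff[of h, OF hx]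
proof (intro allI impI)
  fix e :: real assume "e > 0"
  have "\<forall>\<^sub>F y in at x. norm (f y - f x - f' (y - x)) \<le> e * norm (y - x)"
    using has_derivative_at_bound[OF f \<open>e > 0\<close>] by (simp add: eventually_at_filter eventually_mono)
  then show "\<forall>\<^sub>F y in at x. ereal (f x + c + 0 \<bullet> (y - x) - e * norm (y - x)) \<le> h y"
    using hy by eventually_elim (auto simp: abs_le_iff elim!: order_trans[rotated])
qed

lemma regular_subdiff_imp_limiting:
  assumes "v \<in> regular_subdiff h x"
  shows "v \<in> limiting_subdiff h x"
proof -
  have "\<exists>xs vs. xs \<longlonglongrightarrow> x \<and> (\<lambda>k. h (xs k)) \<longlonglongrightarrow> h x \<and>
      (\<forall>k::nat. vs k \<in> regular_subdiff h (xs k)) \<and> vs \<longlonglongrightarrow> v"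
    using assms by (intro exI[of _ "\<lambda>_. x"] exI[of _ "\<lambda>_. v"]) simp
  moreover have "\<bar>h x\<bar> \<noteq> \<infinity>"
    using assms by (simp add: regular_subdiff_def)
  ultimately show ?thesis
    by (simp add: limiting_subdiff_def)
qed

section \<open>Column supports and their semicontinuity\<close>

definition col_supp :: "real^'q^'p \<Rightarrow> 'q set" where
  "col_supp W = {k. column k W \<noteq> 0}"

lemma nnz_cols_eq_card: "nnz_cols W = card (col_supp W)"
  by (simp add: nnz_cols_def col_supp_def)

lemma mem_col_supp: "k \<in> col_supp W \<longleftrightarrow> (\<exists>i. W $ i $ k \<noteq> 0)"
  by (simp add: col_supp_def column_def vec_eq_iff)

text \<open>A nonzero entry stays nonzero near the limit, and there are only finitely many columns.
  This is the lower semicontinuity of the column count.\<close>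

lemma eventually_col_supp_subset:
  assumes "(g \<longlongrightarrow> W) F"
  shows "\<forall>\<^sub>F t in F. col_supp W \<subseteq> col_supp (g t)"
proof -
  have "\<forall>\<^sub>F t in F. k \<in> col_supp (g t)" if "k \<in> col_supp W" for k
  proof -
    obtain i where "W $ i $ k \<noteq> 0"
      using \<open>k \<in> col_supp W\<close> by (auto simp: mem_col_supp)
    moreover have "((\<lambda>t. g t $ i $ k) \<longlongrightarrow> W $ i $ k) F"
      by (intro tendsto_intros assms)
    ultimately have "\<forall>\<^sub>F t in F. g t $ i $ k \<noteq> 0"
      by (rule tendsto_imp_eventually_ne[rotated])
    then show ?thesis
      by (rule eventually_mono) (simp add: mem_col_supp, blast)
  qed
  then have "\<forall>\<^sub>F t in F. \<forall>k\<in>col_supp W. k \<in> col_supp (g t)"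
    by (intro eventually_ball_finite) auto
  then show ?thesis
    by (simp add: subset_eq)
qed

section \<open>The gradient of the smooth part\<close>

lemma bounded_bilinear_matrix_mult:
  "bounded_bilinear ((**) :: real^'q^'p \<Rightarrow> real^'s^'q \<Rightarrow> real^'s^'p)"
  unfolding bilinear_conv_bounded_bilinear[symmetric]
  by (auto simp: bilinear_def linear_iff matrix_matrix_mult_def vec_eq_iff sum.distrib
      sum_distrib_left algebra_simps)

lemma bounded_linear_transpose: "bounded_linear (transpose :: real^'q^'p \<Rightarrow> real^'p^'q)"
  unfolding linear_conv_bounded_linear[symmetric]
  by (auto simp: linear_iff transpose_def vec_eq_iff)

lemmas has_derivative_matrix_mult [derivative_intros] =
    bounded_bilinear.FDERIV[OF bounded_bilinear_matrix_mult]
  and tendsto_matrix_mult [tendsto_intros] =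
    bounded_bilinear.tendsto[OF bounded_bilinear_matrix_mult]
  and has_derivative_transpose [derivative_intros] =
    bounded_linear.has_derivative[OF bounded_linear_transpose]
  and tendsto_transpose [tendsto_intros] =
    bounded_linear.tendsto[OF bounded_linear_transpose]

text \<open>Right multiplication by \<open>V\<close> is the adjoint of right multiplication by
  \<open>transpose V\<close>; this turns the derivative of the quadratic term into a
  gradient.\<close>

lemma inner_matrix_mult_left:
  fixes R :: "real^'m^'n" and A :: "real^'r^'n" and V :: "real^'r^'m"
  shows "R \<bullet> (A ** transpose V) = (R ** V) \<bullet> A"
proof -
  have "(\<Sum>j\<in>UNIV. R $ i $ j * (\<Sum>k\<in>UNIV. A $ i $ k * V $ j $ k))
      = (\<Sum>k\<in>UNIV. (\<Sum>j\<in>UNIV. R $ i $ j * V $ j $ k) * A $ i $ k)" for i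
    unfolding sum_distrib_left sum_distrib_right
    by (subst sum.swap) (simp add: mult_ac)
  then show ?thesis
    by (simp add: inner_vec_def matrix_matrix_mult_def transpose_def)
qed

lemma inner_transpose: "transpose A \<bullet> transpose B = A \<bullet> (B :: real^'q^'p)"
  by (simp add: inner_vec_def transpose_def) (rule sum.swap)

lemma inner_matrix_mult_right:
  fixes R :: "real^'m^'n" and U :: "real^'r^'n" and B :: "real^'r^'m"
  shows "R \<bullet> (U ** transpose B) = (transpose R ** U) \<bullet> B"
  using inner_matrix_mult_left[of "transpose R" B U]
  by (simp add: matrix_transpose_mul flip: inner_transpose[of R])

definition grad_F :: "real^'m^'n \<Rightarrow> real \<Rightarrow> (real^'r^'n) \<times> (real^'r^'m) \<Rightarrow> (real^'r^'n) \<times> (real^'r^'m)" where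
  "grad_F X \<mu> = (\<lambda>(U, V).
     ((U ** transpose V - X) ** V + \<mu> *\<^sub>R U, transpose (U ** transpose V - X) ** U + \<mu> *\<^sub>R V))"

text \<open>This form keeps the direction inside products with \<open>U\<close> and
  \<open>V\<close>, where disjoint column supports make terms vanish.\<close>

lemma inner_grad_F:
  "grad_F X \<mu> (U, V) \<bullet> (A, B) =
    (U ** transpose V - X) \<bullet> (A ** transpose V + U ** transpose B) + \<mu> * (U \<bullet> A + V \<bullet> B)"
  by (simp add: grad_F_def inner_add_left inner_add_right inner_matrix_mult_left[of _ A V]
      inner_matrix_mult_right[of _ U B] algebra_simps)

lemma F_reg_has_derivative:
  fixes x :: "(real^'r^'n) \<times> (real^'r^'m)"
  shows "(F_reg X \<mu> has_derivative (\<lambda>d. grad_F X \<mu> x \<bullet> d)) (at x)"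
proof -
  let ?R = "\<lambda>x :: (real^'r^'n) \<times> (real^'r^'m). X - fst x ** transpose (snd x)"
  have R: "(?R has_derivative
      (\<lambda>d. - (fst x ** transpose (snd d) + fst d ** transpose (snd x)))) (at x)"
    by (rule derivative_eq_intros refl | simp)+
  \<comment> \<open>Squared norms are written as inner products, and \<open>?D\<close> is the term
    that the product rule yields for them; it is simplified to the gradient afterwards.\<close>
  let ?D = "\<lambda>d. 1/2 * (?R x \<bullet> - (fst x ** transpose (snd d) + fst d ** transpose (snd x))
      + - (fst x ** transpose (snd d) + fst d ** transpose (snd x)) \<bullet> ?R x)
      + \<mu>/2 * (fst x \<bullet> fst d + fst d \<bullet> fst x + (snd x \<bullet> snd d + snd d \<bullet> snd x))"
  have "((\<lambda>x. 1/2 * (?R x \<bullet> ?R x) + \<mu>/2 * (fst x \<bullet> fst x + snd x \<bullet> snd x)) has_derivative ?D) (at x)"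
    by (intro derivative_intros R)
  also have "?D = (\<lambda>d. grad_F X \<mu> x \<bullet> d)"
  proof
    fix d :: "(real^'r^'n) \<times> (real^'r^'m)"
    obtain U V A B where xd: "x = (U, V)" "d = (A, B)"
      by fastforce
    define R where "R = X - U ** transpose V"
    have R: "U ** transpose V - X = - R"
      by (simp add: R_def)
    show "?D d = grad_F X \<mu> x \<bullet> d"
      unfolding xd inner_grad_F R
      by (simp add: inner_commute[of A] inner_commute[of B] inner_commute[of _ R]
          inner_add_right inner_diff_right distrib_left flip: R_def)
  qed
  finally show ?thesis
    by (simp add: F_reg_def case_prod_unfold power2_norm_eq_inner)
qed

lemma tendsto_grad_F:
  assumes "(g \<longlongrightarrow> x) F"
  shows "((\<lambda>t. grad_F X \<mu> (g t)) \<longlongrightarrow> grad_F X \<mu> x) F"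
  unfolding grad_F_def case_prod_unfold by (intro tendsto_intros assms)

section \<open>Disjoint supports and restriction to a set of columns\<close>

lemma matrix_mult_transpose_eq_0:
  assumes "col_supp A \<inter> col_supp B = {}"
  shows "A ** transpose B = 0"
  using assms by (force simp: mem_col_supp matrix_matrix_mult_def transpose_def vec_eq_iff intro!: sum.neutral)

lemma inner_eq_0_if_disjoint_col_supp:
  assumes "col_supp A \<inter> col_supp B = {}"
  shows "A \<bullet> B = 0"
  using assms by (force simp: mem_col_supp inner_vec_def intro!: sum.neutral)

definition restrict_cols :: "'q set \<Rightarrow> real^'q^'p \<Rightarrow> real^'q^'p" where
  "restrict_cols K W = (\<chi> i k. if k \<in> K then W $ i $ k else 0)"

lemma col_supp_restrict_cols: "col_supp (restrict_cols K W) = K \<inter> col_supp W"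
  by (auto simp: mem_col_supp restrict_cols_def split: if_splits)

lemma col_supp_diff_restrict_cols:
  "col_supp (W - restrict_cols K W) = col_supp W - K"
  "col_supp (restrict_cols K W - W) = col_supp W - K"
  by (auto simp: mem_col_supp restrict_cols_def split: if_splits)

lemma nonneg_restrict_cols: "nonneg_mat W \<Longrightarrow> nonneg_mat (restrict_cols K W)"
  by (simp add: nonneg_mat_def restrict_cols_def)

section \<open>Critical points of the penalized objective\<close>

lemma Psi_nonneg:
  "nonneg_mat U \<Longrightarrow> nonneg_mat V \<Longrightarrow>
    Psi X l \<mu> (U, V) = ereal (F_reg X \<mu> (U, V) + l * (real (nnz_cols U) + real (nnz_cols V)))"
  by (simp add: Psi_def F_nonneg_def ind_nonneg_def)

lemma Psi_eq_infinity: "\<not> (nonneg_mat U \<and> nonneg_mat V) \<Longrightarrow> Psi X l \<mu> (U, V) = \<infinity>"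
  by (auto simp: Psi_def F_nonneg_def ind_nonneg_def)

lemma Psi_finiteD:
  assumes "\<bar>Psi X l \<mu> (U, V)\<bar> \<noteq> \<infinity>"
  shows "nonneg_mat U" "nonneg_mat V"
proof -
  have "nonneg_mat U \<and> nonneg_mat V"
    using assms by (rule contrapos_np) (simp add: Psi_eq_infinity)
  then show "nonneg_mat U" "nonneg_mat V"
    by auto
qed

lemma col_supp_0 [simp]: "col_supp 0 = {}"
  by (auto simp: mem_col_supp)

lemma F_nonneg_eq_Psi: "F_nonneg X \<mu> = Psi X 0 \<mu>"
  by (auto simp: Psi_def fun_eq_iff simp flip: zero_ereal_def)

lemma segment_from_nonneg:
  assumes "nonneg_mat W" "nonneg_mat W'" "0 \<le> t" "t \<le> 1"
  shows "nonneg_mat (W + t *\<^sub>R (W' - W))"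
proof -
  have "0 \<le> (1 - t) * W $ i $ j + t * W' $ i $ j" for i j
    using assms by (simp add: nonneg_mat_def)
  then show ?thesis
    by (simp add: nonneg_mat_def algebra_simps)
qed

lemma nnz_cols_segment_le:
  assumes "col_supp W' \<subseteq> col_supp W"
  shows "nnz_cols (W + t *\<^sub>R (W' - W)) \<le> nnz_cols W"
proof -
  have "col_supp (W + t *\<^sub>R (W' - W)) \<subseteq> col_supp W"
    using assms by (force simp: mem_col_supp subset_iff)
  then show ?thesis
    by (simp add: nnz_cols_eq_card card_mono)
qed

text \<open>The segment towards \<open>(U', V')\<close> stays nonnegative by convexity and creates
  no new nonzero column, so on it \<open>Psi\<close> is at most \<open>F_reg\<close> plus the
  penalty at \<open>(U, V)\<close>.\<close>

lemma Psi_regular_subdiff_le: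
  assumes l: "l \<ge> 0"
    and v: "v \<in> regular_subdiff (Psi X l \<mu>) (U, V)"
    and nn: "nonneg_mat U'" "nonneg_mat V'"
    and supp: "col_supp U' \<subseteq> col_supp U" "col_supp V' \<subseteq> col_supp V"
  shows "v \<bullet> ((U', V') - (U, V)) \<le> grad_F X \<mu> (U, V) \<bullet> ((U', V') - (U, V))"
proof (rule regular_subdiff_le_derivative[OF v F_reg_has_derivative])
  let ?c = "l * (real (nnz_cols U) + real (nnz_cols V))"
  have UV: "nonneg_mat U" "nonneg_mat V"
    using v Psi_finiteD[of X l \<mu> U V] by (simp_all add: regular_subdiff_def)
  then show "Psi X l \<mu> (U, V) = ereal (F_reg X \<mu> (U, V) + ?c)"
    by (rule Psi_nonneg)
  have "\<forall>\<^sub>F t in at_right (0::real). 0 < t \<and> t < 1"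
    by (auto simp: eventually_at_right_field intro: exI[of _ 1])
  then show "\<forall>\<^sub>F t in at_right 0. Psi X l \<mu> ((U, V) + t *\<^sub>R ((U', V') - (U, V)))
      \<le> ereal (F_reg X \<mu> ((U, V) + t *\<^sub>R ((U', V') - (U, V))) + ?c)"
  proof eventually_elim
    case (elim t)
    have "l * (real (nnz_cols (U + t *\<^sub>R (U' - U))) + real (nnz_cols (V + t *\<^sub>R (V' - V)))) \<le> ?c"
      using l supp by (intro mult_left_mono add_mono of_nat_mono nnz_cols_segment_le)
    then show ?case
      using elim UV nn by (simp add: Psi_nonneg segment_from_nonneg)
  qed
qed

lemma crit_Psi_nonneg:
  assumes "(U, V) \<in> crit (Psi X l \<mu>)"
  shows "nonneg_mat U" "nonneg_mat V"
  using assms Psi_finiteD[of X l \<mu> U V] by (simp_all add: crit_def limiting_subdiff_def)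

text \<open>The columns that are nonzero in the limit are eventually nonzero along the approximating
  sequence. Hence the fixed target \<open>(U', V')\<close> is admissible for the regular
  subgradients there, and both sides of their inequality converge.\<close>

lemma crit_Psi_supported:
  fixes U U' :: "real^'r^'n" and V V' :: "real^'r^'m"
  assumes l: "l \<ge> 0"
    and crit: "(U, V) \<in> crit (Psi X l \<mu>)"
    and nn: "nonneg_mat U'" "nonneg_mat V'"
    and supp: "col_supp U' \<subseteq> col_supp U" "col_supp V' \<subseteq> col_supp V"
  shows "0 \<le> grad_F X \<mu> (U, V) \<bullet> ((U', V') - (U, V))"
proof -
  obtain xs :: "nat \<Rightarrow> (real^'r^'n) \<times> (real^'r^'m)" and vs
    where xs: "xs \<longlonglongrightarrow> (U, V)" and vs: "vs \<longlonglongrightarrow> 0"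
      and reg: "\<And>k. vs k \<in> regular_subdiff (Psi X l \<mu>) (xs k)"
    using crit unfolding crit_def limiting_subdiff_def by blast
  have "\<forall>\<^sub>F k in sequentially. col_supp U \<subseteq> col_supp (fst (xs k))"
    using tendsto_fst[OF xs] by (intro eventually_col_supp_subset) simp
  moreover have "\<forall>\<^sub>F k in sequentially. col_supp V \<subseteq> col_supp (snd (xs k))"
    using tendsto_snd[OF xs] by (intro eventually_col_supp_subset) simp
  ultimately have "\<forall>\<^sub>F k in sequentially.
      vs k \<bullet> ((U', V') - xs k) \<le> grad_F X \<mu> (xs k) \<bullet> ((U', V') - xs k)"
  proof eventually_elim
    case (elim k)
    then show ?case
      using Psi_regular_subdiff_le[OF l, of "vs k" X \<mu> "fst (xs k)" "snd (xs k)" U' V'] reg nn supp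
      by simp
  qed
  moreover have "(\<lambda>k. vs k \<bullet> ((U', V') - xs k)) \<longlonglongrightarrow> 0 \<bullet> ((U', V') - (U, V))"
    by (intro tendsto_intros xs vs)
  moreover have "(\<lambda>k. grad_F X \<mu> (xs k) \<bullet> ((U', V') - xs k))
      \<longlonglongrightarrow> grad_F X \<mu> (U, V) \<bullet> ((U', V') - (U, V))"
    by (intro tendsto_intros tendsto_grad_F xs)
  ultimately show ?thesis
    using tendsto_le[OF sequentially_bot] by fastforce
qed

text \<open>The kept and the deleted columns are orthogonal.\<close>

lemma inner_diff_restrict_cols:
  "W \<bullet> (restrict_cols K W - W) = - (norm (restrict_cols K W - W))\<^sup>2"
proof -
  have "restrict_cols K W \<bullet> (W - restrict_cols K W) = 0"
    by (rule inner_eq_0_if_disjoint_col_supp)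
      (auto simp: col_supp_restrict_cols col_supp_diff_restrict_cols)
  then show ?thesis
    by (simp add: power2_norm_eq_inner inner_diff_left inner_diff_right inner_commute)
qed

text \<open>Deleting from one factor the columns in which the other one vanishes leaves the product
  unchanged to first order, so only the regularization term reacts, and it strictly decreases unless
  nothing was deleted.\<close>

lemma crit_Psi_col_supp_eq:
  fixes U :: "real^'r^'n" and V :: "real^'r^'m"
  assumes l: "l \<ge> 0" and \<mu>: "\<mu> > 0" and crit: "(U, V) \<in> crit (Psi X l \<mu>)"
  shows "col_supp U = col_supp V"
proof -
  note nn = crit_Psi_nonneg[OF crit]
  define V' where "V' = restrict_cols (col_supp U) V"
  define U' where "U' = restrict_cols (col_supp V) U"
  have U0: "U ** transpose (V' - V) = 0" and V0: "(U' - U) ** transpose V = 0"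
    unfolding U'_def V'_def
    by (intro matrix_mult_transpose_eq_0; auto simp: col_supp_diff_restrict_cols)+
  have "0 \<le> grad_F X \<mu> (U, V) \<bullet> (0, V' - V)"
    using crit_Psi_supported[OF l crit nn(1) nonneg_restrict_cols[OF nn(2)], of "col_supp U"]
    by (simp add: V'_def col_supp_restrict_cols)
  \<comment> \<open>The product terms vanish by \<open>U0\<close>; what remains is
    \<open>\<mu> * (V \<bullet> (V' - V))\<close>.\<close>
  then have "0 \<le> - (\<mu> * (norm (V' - V))\<^sup>2)"
    by (simp add: inner_grad_F matrix_mult_transpose_eq_0 U0) (simp add: V'_def inner_diff_restrict_cols)
  then have "V' = V"
    using \<mu> by (simp add: mult_le_0_iff)
  moreover
  have "0 \<le> grad_F X \<mu> (U, V) \<bullet> (U' - U, 0)"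
    using crit_Psi_supported[OF l crit nonneg_restrict_cols[OF nn(1)] nn(2), of "col_supp V"]
    by (simp add: U'_def col_supp_restrict_cols)
  then have "0 \<le> - (\<mu> * (norm (U' - U))\<^sup>2)"
    by (simp add: inner_grad_F matrix_mult_transpose_eq_0 V0) (simp add: U'_def inner_diff_restrict_cols)
  then have "U' = U"
    using \<mu> by (simp add: mult_le_0_iff)
  ultimately show ?thesis
    using col_supp_restrict_cols[of "col_supp U" V] col_supp_restrict_cols[of "col_supp V" U]
    by (auto simp: U'_def V'_def)
qed

text \<open>Forward, the target is split into its part on the common support, where the restricted
  inequality applies, and a part to which the gradient is orthogonal. Backward, the penalty near
  \<open>(U, V)\<close> is at least its value there, so \<open>F_reg\<close> plus this value bounds
  \<open>Psi\<close> from below.\<close>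

lemma crit_Psi_iff:
  fixes U :: "real^'r^'n" and V :: "real^'r^'m"
  assumes l: "l \<ge> 0" and \<mu>: "\<mu> > 0"
  shows "(U, V) \<in> crit (Psi X l \<mu>) \<longleftrightarrow> nonneg_mat U \<and> nonneg_mat V \<and>
    (\<forall>U' V'. nonneg_mat U' \<longrightarrow> nonneg_mat V' \<longrightarrow>
      0 \<le> grad_F X \<mu> (U, V) \<bullet> ((U', V') - (U, V)))"
proof (intro iffI conjI allI impI)
  assume crit: "(U, V) \<in> crit (Psi X l \<mu>)"
  then show "nonneg_mat U" "nonneg_mat V"
    by (rule crit_Psi_nonneg)+
  fix U' :: "real^'r^'n" and V' :: "real^'r^'m"
  assume nn: "nonneg_mat U'" "nonneg_mat V'"
  define A where "A = restrict_cols (col_supp U) U'"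
  define B where "B = restrict_cols (col_supp V) V'"
  have supp: "col_supp U = col_supp V"
    by (rule crit_Psi_col_supp_eq[OF l \<mu> crit])
  \<comment> \<open>Since the two supports agree, the remainders \<open>U' - A\<close> and
    \<open>V' - B\<close> avoid the nonzero columns of both factors, which kills the product terms
    as well as the regularization terms.\<close>
  have UA: "col_supp (U' - A) \<inter> col_supp V = {}" "col_supp U \<inter> col_supp (U' - A) = {}"
    and VB: "col_supp U \<inter> col_supp (V' - B) = {}" "col_supp V \<inter> col_supp (V' - B) = {}"
    by (auto simp: A_def B_def col_supp_diff_restrict_cols supp)
  have "grad_F X \<mu> (U, V) \<bullet> (U' - A, V' - B) = 0"
    by (simp add: inner_grad_F matrix_mult_transpose_eq_0 inner_eq_0_if_disjoint_col_supp UA VB)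
  moreover have "0 \<le> grad_F X \<mu> (U, V) \<bullet> ((A, B) - (U, V))"
    by (rule crit_Psi_supported[OF l crit])
      (auto simp: A_def B_def col_supp_restrict_cols nonneg_restrict_cols nn)
  moreover have "(U', V') - (U, V) = (U' - A, V' - B) + ((A, B) - (U, V))"
    by simp
  ultimately show "0 \<le> grad_F X \<mu> (U, V) \<bullet> ((U', V') - (U, V))"
    by (simp only: inner_add_right)
next
  assume R: "nonneg_mat U \<and> nonneg_mat V \<and>
    (\<forall>U' V'. nonneg_mat U' \<longrightarrow> nonneg_mat V' \<longrightarrow>
      0 \<le> grad_F X \<mu> (U, V) \<bullet> ((U', V') - (U, V)))"
  let ?c = "l * (real (nnz_cols U) + real (nnz_cols V))"
  have "\<forall>\<^sub>F y in at (U, V). col_supp U \<subseteq> col_supp (fst y)"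
    using tendsto_fst[OF tendsto_ident_at[of "(U, V)" UNIV]] by (intro eventually_col_supp_subset) simp
  moreover have "\<forall>\<^sub>F y in at (U, V). col_supp V \<subseteq> col_supp (snd y)"
    using tendsto_snd[OF tendsto_ident_at[of "(U, V)" UNIV]] by (intro eventually_col_supp_subset) simp
  ultimately have "\<forall>\<^sub>F y in at (U, V). Psi X l \<mu> y = \<infinity> \<or>
      ereal (F_reg X \<mu> y + ?c) \<le> Psi X l \<mu> y \<and> 0 \<le> grad_F X \<mu> (U, V) \<bullet> (y - (U, V))"
  proof eventually_elim
    case (elim y)
    obtain U' V' where y: "y = (U', V')"
      by fastforce
    have "?c \<le> l * (real (nnz_cols U') + real (nnz_cols V'))"
      using l elim by (intro mult_left_mono add_mono of_nat_mono) (auto simp: y nnz_cols_eq_card card_mono)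
    then show ?case
      using R Psi_eq_infinity[of U' V' X l \<mu>]
      by (cases "nonneg_mat U' \<and> nonneg_mat V'") (auto simp: y Psi_nonneg)
  qed
  moreover have "Psi X l \<mu> (U, V) = ereal (F_reg X \<mu> (U, V) + ?c)"
    using R by (simp add: Psi_nonneg)
  ultimately have "0 \<in> regular_subdiff (Psi X l \<mu>) (U, V)"
    by (intro zero_in_regular_subdiffI[OF F_reg_has_derivative])
  then show "(U, V) \<in> crit (Psi X l \<mu>)"
    by (simp add: crit_def regular_subdiff_imp_limiting)
qed

text \<open>The constant \<open>h x\<close> is a minorant of \<open>h\<close> with slope 0.
  Finiteness is a separate assumption because every point globally minimizes a function that is
  identically infinite.\<close>

lemma global_minimizer_imp_crit:
  assumes "global_minimizer h x" "\<bar>h x\<bar> \<noteq> \<infinity>"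
  shows "x \<in> crit h"
proof -
  obtain a where a: "h x = ereal a"
    using assms(2) by auto
  have "ereal (a - e * norm (y - x)) \<le> h y" if "e > 0" for e y
  proof -
    have "ereal (a - e * norm (y - x)) \<le> h x"
      using that by (simp add: a)
    also have "\<dots> \<le> h y"
      using assms(1) by (simp add: global_minimizer_def)
    finally show ?thesis .
  qed
  then have "0 \<in> regular_subdiff h x"
    by (simp add: regular_subdiff_iff[of h, OF a])
  then show ?thesis
    by (simp add: crit_def regular_subdiff_imp_limiting)
qed

section \<open>Nonnegative factorizations and column counts\<close>

definition nonneg_factorization ::
  "real^'q^'p \<Rightarrow> nat \<Rightarrow> ('p \<Rightarrow> nat \<Rightarrow> real) \<Rightarrow> ('q \<Rightarrow> nat \<Rightarrow> real) \<Rightarrow> bool" where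
  "nonneg_factorization A s B C \<longleftrightarrow>
     (\<forall>i. \<forall>k<s. 0 \<le> B i k) \<and> (\<forall>j. \<forall>k<s. 0 \<le> C j k) \<and>
     (\<forall>i j. A $ i $ j = (\<Sum>k<s. B i k * C j k))"

lemma nonneg_rank_eq_Least: "nonneg_rank A = (LEAST s. \<exists>B C. nonneg_factorization A s B C)"
  by (simp add: nonneg_rank_def nonneg_factorization_def)

text \<open>Zero columns of \<open>U\<close> contribute nothing to the product; the others are
  enumerated by \<open>f\<close>.\<close>

lemma nonneg_factorization_nnz_cols:
  assumes "nonneg_mat U" "nonneg_mat V"
  shows "\<exists>B C. nonneg_factorization (U ** transpose V) (nnz_cols U) B C"
proof -
  obtain f where f: "bij_betw f {..<nnz_cols U} (col_supp U)"
    using ex_bij_betw_nat_finite[of "col_supp U"]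
    by (auto simp: nnz_cols_eq_card lessThan_atLeast0)
  have "(U ** transpose V) $ i $ j = (\<Sum>k<nnz_cols U. U $ i $ f k * V $ j $ f k)" for i j
  proof -
    have "(U ** transpose V) $ i $ j = (\<Sum>k\<in>UNIV. U $ i $ k * V $ j $ k)"
      by (simp add: matrix_matrix_mult_def transpose_def)
    also have "\<dots> = (\<Sum>k\<in>col_supp U. U $ i $ k * V $ j $ k)"
      by (rule sum.mono_neutral_right) (auto simp: mem_col_supp)
    finally show ?thesis
      by (simp add: sum.reindex_bij_betw[OF f, of "\<lambda>k. U $ i $ k * V $ j $ k"])
  qed
  then have "nonneg_factorization (U ** transpose V) (nnz_cols U) (\<lambda>i k. U $ i $ f k) (\<lambda>j k. V $ j $ f k)"
    using assms by (simp add: nonneg_factorization_def nonneg_mat_def)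
  then show ?thesis
    by blast
qed

text \<open>The \<open>s\<close> abstract columns are placed injectively among the indices of type
  \<open>'r\<close>, and the remaining columns are filled with zeros.\<close>

lemma nonneg_factorization_matrices:
  fixes A :: "real^'m^'n"
  assumes fac: "nonneg_factorization A s B C" and s: "s \<le> CARD('r::finite)"
  obtains U :: "real^'r^'n" and V :: "real^'r^'m" where
    "nonneg_mat U" "nonneg_mat V" "A = U ** transpose V" "nnz_cols U \<le> s" "nnz_cols V \<le> s"
proof -
  obtain f :: "nat \<Rightarrow> 'r" where f: "inj_on f {..<s}"
    using card_le_inj[of "{..<s}" "UNIV :: 'r set"] s by auto
  define g where "g = the_inv_into {..<s} f"
  have gf: "g (f k) = k" if "k < s" for k
    using f that by (simp add: g_def the_inv_into_f_f)
  define U :: "real^'r^'n" where "U = (\<chi> i k. if k \<in> f ` {..<s} then B i (g k) else 0)"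
  define V :: "real^'r^'m" where "V = (\<chi> j k. if k \<in> f ` {..<s} then C j (g k) else 0)"
  have "col_supp U \<subseteq> f ` {..<s}" "col_supp V \<subseteq> f ` {..<s}"
    by (auto simp: U_def V_def mem_col_supp split: if_splits)
  then have "nnz_cols U \<le> s" "nnz_cols V \<le> s"
    using card_mono[of "f ` {..<s}"] by (auto simp: nnz_cols_eq_card card_image[OF f])
  moreover have "A = U ** transpose V"
  proof -
    have "(\<Sum>k\<in>UNIV. U $ i $ k * V $ j $ k) = A $ i $ j" for i j
    proof -
      have "(\<Sum>k\<in>UNIV. U $ i $ k * V $ j $ k) = (\<Sum>k\<in>f ` {..<s}. U $ i $ k * V $ j $ k)"
        by (rule sum.mono_neutral_right) (auto simp: U_def)
      also have "\<dots> = (\<Sum>k<s. B i k * C j k)"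
        by (simp add: sum.reindex[OF f] U_def V_def gf)
      finally show ?thesis
        using fac by (simp add: nonneg_factorization_def)
    qed
    then show ?thesis
      by (simp add: vec_eq_iff matrix_matrix_mult_def transpose_def)
  qed
  moreover have "nonneg_mat U" "nonneg_mat V"
    using fac by (auto simp: nonneg_factorization_def nonneg_mat_def U_def V_def gf)
  ultimately show ?thesis
    using that by blast
qed

section \<open>Norm estimates and balanced factors\<close>

lemma power2_norm_vec: "(norm (x :: real^'n))\<^sup>2 = (\<Sum>i\<in>UNIV. (x $ i)\<^sup>2)"
  by (simp add: norm_vec_def L2_set_def sum_nonneg)

lemma power2_norm_matrix:
  "(norm (A :: real^'q^'p))\<^sup>2 = (\<Sum>i\<in>UNIV. \<Sum>j\<in>UNIV. (A $ i $ j)\<^sup>2)"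
  by (simp add: norm_matrix_eq_frobenius sum_nonneg)

lemma power2_norm_eq_sum_columns:
  "(norm (A :: real^'q^'p))\<^sup>2 = (\<Sum>k\<in>UNIV. (norm (column k A))\<^sup>2)"
  unfolding power2_norm_matrix by (subst sum.swap) (simp add: power2_norm_vec column_def)

lemma sum_power2_le_power2_sum:
  fixes a :: "'a \<Rightarrow> real"
  assumes "\<And>k. k \<in> K \<Longrightarrow> 0 \<le> a k"
  shows "(\<Sum>k\<in>K. (a k)\<^sup>2) \<le> (\<Sum>k\<in>K. a k)\<^sup>2"
proof -
  have "(L2_set a K)\<^sup>2 \<le> (\<Sum>k\<in>K. a k)\<^sup>2"
    using assms by (intro power_mono L2_set_le_sum) (auto simp: L2_set_nonneg)
  then show ?thesis
    by (simp add: L2_set_def sum_nonneg)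
qed

text \<open>Each summand is the Frobenius norm of a rank-one term of the product. All entries being
  nonnegative, the cross terms in the squared norm of the product are nonnegative, which bounds the
  sum of squares; Cauchy-Schwarz over at most \<open>s\<close> nonzero columns does the
  rest.\<close>

lemma sum_norm_columns_le:
  fixes U :: "real^'r^'n" and V :: "real^'r^'m"
  assumes nn: "nonneg_mat U" "nonneg_mat V" and s: "nnz_cols U \<le> s"
  shows "(\<Sum>k\<in>UNIV. norm (column k U) * norm (column k V)) \<le> sqrt (real s) * norm (U ** transpose V)"
proof -
  let ?p = "\<lambda>k. norm (column k U) * norm (column k V)"
  have "(?p k)\<^sup>2 = (\<Sum>i\<in>UNIV. \<Sum>j\<in>UNIV. (U $ i $ k * V $ j $ k)\<^sup>2)" for k
    by (simp add: power_mult_distrib power2_norm_vec column_def sum_product)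
  then have "(\<Sum>k\<in>UNIV. (?p k)\<^sup>2) = (\<Sum>k\<in>UNIV. \<Sum>i\<in>UNIV. \<Sum>j\<in>UNIV. (U $ i $ k * V $ j $ k)\<^sup>2)"
    by simp
  also have "\<dots> = (\<Sum>i\<in>UNIV. \<Sum>j\<in>UNIV. \<Sum>k\<in>UNIV. (U $ i $ k * V $ j $ k)\<^sup>2)"
    by (subst sum.swap, rule sum.cong[OF refl], rule sum.swap)
  also have "\<dots> \<le> (\<Sum>i\<in>UNIV. \<Sum>j\<in>UNIV. (\<Sum>k\<in>UNIV. U $ i $ k * V $ j $ k)\<^sup>2)"
    using nn by (intro sum_mono sum_power2_le_power2_sum) (simp add: nonneg_mat_def)
  also have "\<dots> = (norm (U ** transpose V))\<^sup>2"
    by (simp add: power2_norm_matrix matrix_matrix_mult_def transpose_def)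
  finally have le: "(\<Sum>k\<in>UNIV. (?p k)\<^sup>2) \<le> (norm (U ** transpose V))\<^sup>2" .
  \<comment> \<open>Passing to the support of \<open>U\<close> before Cauchy-Schwarz gives the
    factor \<open>s\<close> instead of the full number of columns.\<close>
  have "(\<Sum>k\<in>UNIV. ?p k)\<^sup>2 = (\<Sum>k\<in>col_supp U. ?p k)\<^sup>2"
    by (intro arg_cong[where f = "\<lambda>x. x\<^sup>2"] sum.mono_neutral_right) (auto simp: col_supp_def)
  also have "\<dots> \<le> (\<Sum>k\<in>col_supp U. (?p k)\<^sup>2) * real (nnz_cols U)"
    unfolding nnz_cols_eq_card by (rule sum_squared_le_sum_of_squares)
  also have "\<dots> \<le> (\<Sum>k\<in>UNIV. (?p k)\<^sup>2) * real s"
    using s by (intro mult_mono sum_mono2) (auto simp: sum_nonneg)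
  also have "\<dots> \<le> (norm (U ** transpose V))\<^sup>2 * real s"
    using le by (rule mult_right_mono) simp
  also have "\<dots> = (sqrt (real s) * norm (U ** transpose V))\<^sup>2"
    by (simp add: power_mult_distrib)
  finally show ?thesis
    by (rule power2_le_imp_le) simp
qed

text \<open>Scaling a column pair by reciprocal factors keeps its rank-one term; with equal norms
  the sum of the two squared norms becomes twice their product, the equality case of the
  arithmetic-geometric mean inequality.\<close>

lemma balanced_factorization:
  fixes U :: "real^'r^'n" and V :: "real^'r^'m"
  assumes nn: "nonneg_mat U" "nonneg_mat V" and s: "nnz_cols U \<le> s" "nnz_cols V \<le> s"
  obtains U' :: "real^'r^'n" and V' :: "real^'r^'m" where
    "nonneg_mat U'" "nonneg_mat V'" "U' ** transpose V' = U ** transpose V"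
    "nnz_cols U' \<le> s" "nnz_cols V' \<le> s"
    "(norm U')\<^sup>2 + (norm V')\<^sup>2 \<le> 2 * (sqrt (real s) * norm (U ** transpose V))"
proof -
  define u where "u k = norm (column k U)" for k
  define v where "v k = norm (column k V)" for k
  have uv: "0 \<le> u k" "0 \<le> v k" for k
    by (simp_all add: u_def v_def)
  have u0: "u k = 0 \<Longrightarrow> U $ i $ k = 0" and v0: "v k = 0 \<Longrightarrow> V $ j $ k = 0" for i j k
    by (simp_all add: u_def v_def column_def vec_eq_iff)
  \<comment> \<open>The factors are \<open>0\<close> when \<open>u k = 0\<close> or \<open>v k = 0\<close>, by \<open>x / 0 = 0\<close>: a pair with one zero column is
    replaced by two zero columns.\<close>
  define U' :: "real^'r^'n" where "U' = (\<chi> i k. sqrt (v k / u k) * U $ i $ k)"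
  define V' :: "real^'r^'m" where "V' = (\<chi> j k. sqrt (u k / v k) * V $ j $ k)"
  have cU: "column k U' = sqrt (v k / u k) *\<^sub>R column k U" for k
    by (simp add: U'_def column_def vec_eq_iff)
  have cV: "column k V' = sqrt (u k / v k) *\<^sub>R column k V" for k
    by (simp add: V'_def column_def vec_eq_iff)
  have sq: "(sqrt (b / a) * a)\<^sup>2 = a * b" if "0 \<le> a" "0 \<le> b" for a b
    using that by (cases "a = 0") (auto simp: power_mult_distrib power2_eq_square[of a])
  have "(norm (column k U'))\<^sup>2 = u k * v k" "(norm (column k V'))\<^sup>2 = u k * v k" for k
    using sq[of "u k" "v k"] sq[of "v k" "u k"] uv[of k]
    by (simp_all add: cU cV u_def[symmetric] v_def[symmetric])
  then have "(norm U')\<^sup>2 + (norm V')\<^sup>2 = 2 * (\<Sum>k\<in>UNIV. u k * v k)"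
    by (simp add: power2_norm_eq_sum_columns)
  also have "\<dots> \<le> 2 * (sqrt (real s) * norm (U ** transpose V))"
    using sum_norm_columns_le[OF nn s(1)] by (simp add: u_def v_def)
  finally have norms: "(norm U')\<^sup>2 + (norm V')\<^sup>2 \<le> 2 * (sqrt (real s) * norm (U ** transpose V))" .
  have "U' $ i $ k * V' $ j $ k = U $ i $ k * V $ j $ k" for i j k
  proof (cases "u k = 0 \<or> v k = 0")
    case True
    then show ?thesis
      using u0 v0 by (auto simp: U'_def V'_def)
  next
    case False
    then have "sqrt (v k / u k) * sqrt (u k / v k) = 1"
      using uv[of k] by (simp flip: real_sqrt_mult)
    moreover have "U' $ i $ k * V' $ j $ k
        = (sqrt (v k / u k) * sqrt (u k / v k)) * (U $ i $ k * V $ j $ k)"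
      by (simp add: U'_def V'_def)
    ultimately show ?thesis
      by simp
  qed
  then have "U' ** transpose V' = U ** transpose V"
    by (simp add: vec_eq_iff matrix_matrix_mult_def transpose_def)
  moreover have "nonneg_mat U'" "nonneg_mat V'"
    using nn uv by (auto simp: nonneg_mat_def U'_def V'_def)
  moreover have "col_supp U' \<subseteq> col_supp U" "col_supp V' \<subseteq> col_supp V"
    by (auto simp: mem_col_supp U'_def V'_def)
  then have "nnz_cols U' \<le> s" "nnz_cols V' \<le> s"
    using s card_mono[of "col_supp U" "col_supp U'"] card_mono[of "col_supp V" "col_supp V'"]
    by (auto simp: nnz_cols_eq_card)
  ultimately show ?thesis
    using norms that by blast
qed

section \<open>Global minimizers and the nonnegative rank\<close>

lemma global_minimizer_Psi_nonneg:
  fixes U :: "real^'r^'n" and V :: "real^'r^'m"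
  assumes "global_minimizer (Psi X l \<mu>) (U, V)"
  shows "nonneg_mat U" "nonneg_mat V"
proof -
  \<comment> \<open>The zero pair is feasible, so the minimal value is finite.\<close>
  have "Psi X l \<mu> (U, V) \<le> Psi X l \<mu> (0 :: real^'r^'n, 0 :: real^'r^'m)"
    using assms unfolding global_minimizer_def by blast
  also have "\<dots> < \<infinity>"
    by (simp add: Psi_nonneg nonneg_mat_def)
  finally have "nonneg_mat U \<and> nonneg_mat V"
    using Psi_eq_infinity[of U V X l \<mu>] by force
  then show "nonneg_mat U" "nonneg_mat V"
    by auto
qed

lemma nonneg_rank_global_minimizer:
  fixes U :: "real^'r^'n" and V :: "real^'r^'m"
  assumes l: "l > 0" and \<mu>: "\<mu> > 0"
    and min: "global_minimizer (Psi X l \<mu>) (U, V)"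
    and bound: "2 * l / \<mu> \<ge> sqrt (real (nonneg_rank (U ** transpose V))) * norm (U ** transpose V)"
  shows "nonneg_rank (U ** transpose V) = nnz_cols U" "nnz_cols U = nnz_cols V"
proof -
  define A where "A = U ** transpose V"
  define s where "s = nonneg_rank A"
  note nn = global_minimizer_Psi_nonneg[OF min]
  have "(U, V) \<in> crit (Psi X l \<mu>)"
    using global_minimizer_imp_crit[OF min] by (simp add: Psi_nonneg nn)
  then have "col_supp U = col_supp V"
    using crit_Psi_col_supp_eq l \<mu> by (metis less_imp_le)
  then show eq: "nnz_cols U = nnz_cols V"
    by (simp add: nnz_cols_eq_card)
  \<comment> \<open>This serves twice: it bounds the least size \<open>s\<close> from above, and it
    shows that the least size is attained.\<close>
  have ex: "\<exists>B C. nonneg_factorization A (nnz_cols U) B C"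
    unfolding A_def by (rule nonneg_factorization_nnz_cols[OF nn])
  have "s \<le> nnz_cols U"
    unfolding s_def nonneg_rank_eq_Least using ex by (rule Least_le)
  moreover have "\<not> s < nnz_cols U"
  proof
    assume less: "s < nnz_cols U"
    \<comment> \<open>A factorization of size \<open>s\<close> must fit into matrices with columns
      indexed by \<open>'r\<close> to compete with \<open>(U, V)\<close>.\<close>
    have "nnz_cols U \<le> CARD('r)"
      by (simp add: nnz_cols_eq_card card_mono)
    then have s: "s \<le> CARD('r)"
      using less by simp
    obtain B C where fac: "nonneg_factorization A s B C"
      using LeastI[of "\<lambda>s. \<exists>B C. nonneg_factorization A s B C", OF ex]
      unfolding s_def nonneg_rank_eq_Least by blast
    obtain U1 :: "real^'r^'n" and V1 :: "real^'r^'m" where 1: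
      "nonneg_mat U1" "nonneg_mat V1" "A = U1 ** transpose V1" "nnz_cols U1 \<le> s" "nnz_cols V1 \<le> s"
      by (rule nonneg_factorization_matrices[OF fac s])
    obtain U2 :: "real^'r^'n" and V2 :: "real^'r^'m" where 2:
      "nonneg_mat U2" "nonneg_mat V2" "U2 ** transpose V2 = A" "nnz_cols U2 \<le> s" "nnz_cols V2 \<le> s"
      "(norm U2)\<^sup>2 + (norm V2)\<^sup>2 \<le> 2 * (sqrt (real s) * norm A)"
      using balanced_factorization[OF 1(1,2,4,5)] unfolding 1(3)[symmetric] by blast
    have "Psi X l \<mu> (U, V) \<le> Psi X l \<mu> (U2, V2)"
      using min unfolding global_minimizer_def by blast
    then have le: "\<mu>/2 * ((norm U)\<^sup>2 + (norm V)\<^sup>2) + l * (real (nnz_cols U) + real (nnz_cols V))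
        \<le> \<mu>/2 * ((norm U2)\<^sup>2 + (norm V2)\<^sup>2) + l * (real (nnz_cols U2) + real (nnz_cols V2))"
      by (simp add: Psi_nonneg nn 2(1-3) F_reg_def flip: A_def)
    have "\<mu>/2 * ((norm U2)\<^sup>2 + (norm V2)\<^sup>2) \<le> \<mu>/2 * (2 * (sqrt (real s) * norm A))"
      using 2(6) \<mu> by (intro mult_left_mono) auto
    also have "\<dots> \<le> 2 * l"
      using bound \<mu> by (simp add: s_def A_def field_simps)
    finally have 3: "\<mu>/2 * ((norm U2)\<^sup>2 + (norm V2)\<^sup>2) \<le> 2 * l" .
    \<comment> \<open>Both \<open>U\<close> and \<open>V\<close> have at least \<open>s + 1\<close>
      nonzero columns, while \<open>U2\<close> and \<open>V2\<close> have at most \<open>s\<close>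
      each; this saves at least one column per factor.\<close>
    have 4: "l * (real (nnz_cols U2) + real (nnz_cols V2)) + 2 * l \<le> l * (real (nnz_cols U) + real (nnz_cols V))"
    proof -
      have "l * (real (nnz_cols U2) + real (nnz_cols V2) + 2) \<le> l * (real (nnz_cols U) + real (nnz_cols V))"
        using less eq 2(4,5) l by (intro mult_left_mono) linarith+
      then show ?thesis
        by (simp add: algebra_simps)
    qed
    \<comment> \<open>The bound on \<open>l\<close> is not strict, so the comparison alone gives no
      contradiction. It forces the regularization of \<open>(U, V)\<close> itself down to zero,
      hence \<open>U = 0\<close>, although \<open>U\<close> has more than \<open>s\<close> nonzero
      columns.\<close>
    have "\<mu>/2 * ((norm U)\<^sup>2 + (norm V)\<^sup>2) \<le> 0"
      using le 3 4 by linarith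
    then have "U = 0"
      using \<mu> by (simp add: mult_le_0_iff sum_power2_le_zero_iff)
    then show False
      using less by (simp add: nnz_cols_eq_card col_supp_def column_def vec_eq_iff)
  qed
  ultimately show "nonneg_rank (U ** transpose V) = nnz_cols U"
    by (simp add: s_def A_def)
qed

theorem proposition2:
  fixes X :: "real^'m^'n" and l \<mu> :: real
  assumes "nonneg_mat X" and "l > 0" and "\<mu> > 0"
  shows "crit (Psi X l \<mu> :: (real^'r^'n) \<times> (real^'r^'m) \<Rightarrow> ereal) = crit (F_nonneg X \<mu>) \<and>
    (\<forall>(U :: real^'r^'n) (V :: real^'r^'m).
       global_minimizer (Psi X l \<mu>) (U, V) \<longrightarrow>
       2 * l / \<mu> \<ge> sqrt (real (nonneg_rank (U ** transpose V))) * norm (U ** transpose V) \<longrightarrow>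
       nonneg_rank (U ** transpose V) = nnz_cols U \<and> nnz_cols U = nnz_cols V)"
proof (intro conjI allI impI)
  show "crit (Psi X l \<mu> :: (real^'r^'n) \<times> (real^'r^'m) \<Rightarrow> ereal) = crit (F_nonneg X \<mu>)"
  proof (rule set_eqI)
    fix x :: "(real^'r^'n) \<times> (real^'r^'m)"
    obtain U V where "x = (U, V)"
      by fastforce
    then show "x \<in> crit (Psi X l \<mu>) \<longleftrightarrow> x \<in> crit (F_nonneg X \<mu>)"
      using assms crit_Psi_iff[of l \<mu> U V X] crit_Psi_iff[of 0 \<mu> U V X]
      by (simp only: F_nonneg_eq_Psi less_imp_le order_refl)
  qed
next
  fix U :: "real^'r^'n" and V :: "real^'r^'m"
  assume *: "global_minimizer (Psi X l \<mu>) (U, V)"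
    "2 * l / \<mu> \<ge> sqrt (real (nonneg_rank (U ** transpose V))) * norm (U ** transpose V)"
  show "nonneg_rank (U ** transpose V) = nnz_cols U"
    by (rule nonneg_rank_global_minimizer(1)[OF assms(2,3) *])
  show "nnz_cols U = nnz_cols V"
    by (rule nonneg_rank_global_minimizer(2)[OF assms(2,3) *])
qed

end
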